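(* Let $\alpha>0$ be an ordinal and $S\subseteq\mathbb{N}^\mathbb{N}$. The following are equivalent: (i) $S$ is guessable with $<\alpha+1$ mind changes; (ii) $S\in D_\alpha$ or $\mathbb{N}^\mathbb{N}\setminus S\in D_\alpha$.
   Context: $\mathbb{N}^\mathbb{N}$ has the Baire space topology (basic open sets: all extensions of a fixed finite sequence). $\mathbb{N}^{<\mathbb{N}}$ is the set of finite sequences; $f\upharpoonright n$ is the length-$n$ initial segment of $f$; $\chi_S$ is the characteristic function of $S$. $G:\mathbb{N}^{<\mathbb{N}}\to\{0,1\}$ is an $S$-guesser if $\lim_nG(f\upharpoonright n)=\chi_S(f)$ for all $f$. For an ordinal $\gamma$, $S$ is guessable with $<\gamma$ mind changes if there are an $S$-guesser $G$ and $H:\mathbb{N}^{<\mathbb{N}}\to\gamma$ such that for all $f,n$: $H(f\upharpoonright(n+1))\le H(f\upharpoonright n)$, and if $G(f\upharpoonright(n+1))\ne G(f\upharpoonright n)$ then $H(f\upharpoonright(n+1))<H(f\upharpoonright n)$. The parity of an ordinal $\eta=\lambda+n$ ($\lambda$ zero or a limit ordinal, $n\in\mathbb{N}$) is $n\bmod 2$. For $\theta\ge1$ and an increasing sequence $(A_\eta)_{\eta<\theta}$ of subsets of $\mathbb{N}^\mathbb{N}$, $x\in D_\theta((A_\eta)_{\eta<\theta})$ iff $x\in\bigcup_{\eta<\theta}A_\eta$ and the least $\eta$ with $x\in A_\eta$ has parity opposite to that of $\theta$. $D_\theta$ is the set of all $D_\theta((A_\eta)_{\eta<\theta})$ with each $A_\eta$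 open. *)

theory Defs
  imports "HOL-Analysis.Function_Topology" "HOL-Library.Indicator_Function"
begin

text \<open>
  Ordinals are the elements of an arbitrary well-ordered type without largest element:
  an element \<open>\<alpha>\<close> stands for the order type of its set \<open>{..<\<alpha>}\<close> of predecessors, so that
  \<open>\<eta> < \<alpha>\<close> has its usual meaning. Every ordinal arises in this way, since it is a proper
  initial segment of some limit ordinal, and absence of a largest element ensures that
  \<open>\<alpha> + 1\<close> exists. A statement with a free type variable of sort \<open>{wellorder, no_top}\<close>
  is therefore a statement about all ordinals.
\<close>

definition ord_zero :: "'o::wellorder" where
  "ord_zero = (LEAST \<beta>. True)"

definition ord_suc :: "'o::{wellorder,no_top} \<Rightarrow> 'o" where
  "ord_suc \<alpha> = (LEAST \<beta>. \<alpha> < \<beta>)"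

definition limit_ord :: "'o::{wellorder,no_top} \<Rightarrow> bool" where
  "limit_ord \<mu> \<longleftrightarrow> \<mu> \<noteq> ord_zero \<and> (\<forall>\<beta>. \<mu> \<noteq> ord_suc \<beta>)"

text \<open>The ordinal \<open>\<mu> + n\<close> is \<open>(ord_suc ^^ n) \<mu>\<close>; see \<open>ord_decomp\<close> below for existence and
  uniqueness of the decomposition.\<close>

definition ord_parity :: "'o::{wellorder,no_top} \<Rightarrow> nat" where
  "ord_parity \<eta> = (THE p. \<exists>\<mu> n. (\<mu> = ord_zero \<or> limit_ord \<mu>) \<and> \<eta> = (ord_suc ^^ n) \<mu> \<and> p = n mod 2)"

definition initial_segment :: "(nat \<Rightarrow> nat) \<Rightarrow> nat \<Rightarrow> nat list" (infix "\<restriction>" 100) where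
  "f \<restriction> n = map f [0..<n]"

definition is_guesser :: "(nat \<Rightarrow> nat) set \<Rightarrow> (nat list \<Rightarrow> nat) \<Rightarrow> bool" where
  "is_guesser S G \<longleftrightarrow> range G \<subseteq> {0, 1} \<and> (\<forall>f. (\<lambda>n. G (f \<restriction> n)) \<longlonglongrightarrow> indicator S f)"

definition guessable_with_less_mind_changes ::
    "'o::{wellorder,no_top} \<Rightarrow> (nat \<Rightarrow> nat) set \<Rightarrow> bool" where
  "guessable_with_less_mind_changes \<gamma> S \<longleftrightarrow>
     (\<exists>(G :: nat list \<Rightarrow> nat) (H :: nat list \<Rightarrow> 'o).
        is_guesser S G \<and> range H \<subseteq> {..<\<gamma>} \<and>
        (\<forall>f n. H (f \<restriction> (n + 1)) \<le> H (f \<restriction> n) \<and>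
               (G (f \<restriction> (n + 1)) \<noteq> G (f \<restriction> n) \<longrightarrow> H (f \<restriction> (n + 1)) < H (f \<restriction> n))))"

text \<open>Sequences indexed by \<open>\<eta> < \<theta>\<close> are functions on the whole type of ordinals whose values
  outside \<open>{..<\<theta>}\<close> are ignored.\<close>

definition difference_set ::
    "'o::{wellorder,no_top} \<Rightarrow> ('o \<Rightarrow> (nat \<Rightarrow> nat) set) \<Rightarrow> (nat \<Rightarrow> nat) set" where
  "difference_set \<theta> A =
     {x. x \<in> (\<Union>\<eta>\<in>{..<\<theta>}. A \<eta>) \<and>
         ord_parity (LEAST \<eta>. \<eta> < \<theta> \<and> x \<in> A \<eta>) \<noteq> ord_parity \<theta>}"

text \<open>\<open>open\<close> on \<open>nat \<Rightarrow> nat\<close> is the library's product of discrete topologies; \<open>baire_open_iff\<close>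
  below identifies it with the topology generated by the sets of all extensions of a fixed
  finite sequence.\<close>

definition difference_class :: "'o::{wellorder,no_top} \<Rightarrow> (nat \<Rightarrow> nat) set set" where
  "difference_class \<theta> =
     {difference_set \<theta> A | A. mono_on {..<\<theta>} A \<and> (\<forall>\<eta><\<theta>. open (A \<eta>))}"

lemma less_ord_suc: "\<alpha> < ord_suc \<alpha>"
  unfolding ord_suc_def using gt_ex[of \<alpha>] by (metis LeastI)

lemma ord_suc_least: "\<alpha> < \<beta> \<Longrightarrow> ord_suc \<alpha> \<le> \<beta>"
  unfolding ord_suc_def by (rule Least_le)

lemma ord_suc_inject: "ord_suc \<alpha> = ord_suc \<beta> \<Longrightarrow> \<alpha> = \<beta>"
  by (metis leD less_ord_suc ord_suc_least linorder_cases)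

lemma ord_zero_le: "ord_zero \<le> \<alpha>"
  unfolding ord_zero_def by (rule Least_le) simp

lemma ord_decomp:
  fixes \<eta> :: "'o::{wellorder,no_top}"
  shows "\<exists>!(\<mu>, n). (\<mu> = ord_zero \<or> limit_ord \<mu>) \<and> \<eta> = (ord_suc ^^ n) \<mu>"
proof -
  let ?B = "\<lambda>\<mu>::'o. \<mu> = ord_zero \<or> limit_ord \<mu>"
  have ex: "\<exists>\<mu> n. ?B \<mu> \<and> \<eta> = (ord_suc ^^ n) \<mu>"
  proof (induction \<eta> rule: less_induct)
    case (less \<eta>)
    show ?case
    proof (cases "?B \<eta>")
      case True
      then have "?B \<eta> \<and> \<eta> = (ord_suc ^^ 0) \<eta>" by simp
      then show ?thesis by blast
    next
      case False
      then obtain \<beta> where \<beta>: "\<eta> = ord_suc \<beta>" unfolding limit_ord_def by blast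
      then obtain \<mu> n where "?B \<mu>" "\<beta> = (ord_suc ^^ n) \<mu>" using less less_ord_suc by blast
      then have "?B \<mu> \<and> \<eta> = (ord_suc ^^ Suc n) \<mu>" using \<beta> by simp
      then show ?thesis by blast
    qed
  qed
  have not_suc: "\<not> ?B (ord_suc \<beta>)" for \<beta>
    unfolding limit_ord_def using less_ord_suc[of \<beta>] ord_zero_le[of \<beta>] by auto
  have uniq: "\<mu> = \<nu> \<and> m = n"
    if "?B \<mu>" "?B \<nu>" "(ord_suc ^^ m) \<mu> = (ord_suc ^^ n) \<nu>" for \<mu> \<nu> m n
    using that
  proof (induction m arbitrary: n)
    case 0
    then show ?case using not_suc by (cases n) auto
  next
    case (Suc m)
    then show ?case using not_suc by (cases n) (auto dest: ord_suc_inject)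
  qed
  show ?thesis using ex uniq by (auto simp: Ex1_def) metis+
qed

lemma ord_parity_eq:
  assumes "\<mu> = ord_zero \<or> limit_ord \<mu>"
  shows "ord_parity ((ord_suc ^^ n) \<mu>) = n mod 2"
  unfolding ord_parity_def
proof (rule the_equality)
  fix p
  assume "\<exists>\<nu> m. (\<nu> = ord_zero \<or> limit_ord \<nu>) \<and> (ord_suc ^^ n) \<mu> = (ord_suc ^^ m) \<nu> \<and> p = m mod 2"
  then show "p = n mod 2" using ord_decomp[of "(ord_suc ^^ n) \<mu>"] assms by blast
qed (use assms in blast)

lemma baire_open_iff:
  fixes A :: "(nat \<Rightarrow> nat) set"
  shows "open A \<longleftrightarrow> (\<forall>f\<in>A. \<exists>n. {g. g \<restriction> n = f \<restriction> n} \<subseteq> A)"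
proof -
  have seg: "g \<restriction> n = f \<restriction> n \<longleftrightarrow> (\<forall>i<n. g i = f i)" for f g n
    by (auto simp: initial_segment_def)
  have cyl: "open {g. \<forall>i<n. g i = f i}" for f :: "nat \<Rightarrow> nat" and n
  proof -
    have "{g. \<forall>i<n. g i = f i} = Pi\<^sub>E UNIV (\<lambda>i. if i < n then {f i} else UNIV)"
      by (auto simp: PiE_iff split: if_splits)
    moreover have "open (Pi\<^sub>E UNIV (\<lambda>i. if i < n then {f i} else UNIV))"
      by (rule open_PiE) (auto simp: open_discrete)
    ultimately show ?thesis by simp
  qed
  show ?thesis
  proof
    assume "open A"
    show "\<forall>f\<in>A. \<exists>n. {g. g \<restriction> n = f \<restriction> n} \<subseteq> A"
    proof
      fix f assume "f \<in> A"
      then obtain X where X: "f \<in> Pi\<^sub>E UNIV X" "finite {i. X i \<noteq> UNIV}" "Pi\<^sub>E UNIV X \<subseteq> A"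
        using product_topology_open_contains_basis[of "\<lambda>_. euclidean" UNIV A f] \<open>open A\<close>
        unfolding open_fun_def by auto
      then obtain n where n: "\<And>i. X i \<noteq> UNIV \<Longrightarrow> i < n"
        using finite_nat_set_iff_bounded[of "{i. X i \<noteq> UNIV}"] by blast
      have "{g. g \<restriction> n = f \<restriction> n} \<subseteq> Pi\<^sub>E UNIV X"
        unfolding seg using X(1) n by (auto simp: PiE_iff) (metis UNIV_I)
      then show "\<exists>n. {g. g \<restriction> n = f \<restriction> n} \<subseteq> A" using X(3) by blast
    qed
  next
    assume R: "\<forall>f\<in>A. \<exists>n. {g. g \<restriction> n = f \<restriction> n} \<subseteq> A"
    show "open A"
      unfolding open_subopen[of A]
    proof
      fix f assume "f \<in> A"
      then obtain n where "{g. g \<restriction> n = f \<restriction> n} \<subseteq> A" using R by blast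
      then show "\<exists>T. open T \<and> f \<in> T \<and> T \<subseteq> A"
        using cyl[of n f] unfolding seg by blast
    qed
  qed
qed

end

theory Submission
  imports Defs
begin

text \<open>
  A guesser and a difference representation are two descriptions of one object, a bound that
  decreases along each \<open>f\<close>. Given open sets \<open>A \<eta>\<close>, let \<open>H s\<close> be the least \<open>\<eta> < \<alpha>\<close> for which
  \<open>A \<eta>\<close> contains all extensions of \<open>s\<close>, and \<open>\<alpha>\<close> if there is none; guess that \<open>f\<close> belongs to
  the set iff the parity of \<open>H s\<close> differs from that of \<open>\<alpha>\<close>. Conversely, given \<open>G\<close> and \<open>H\<close>
  where \<open>G\<close> initially guesses \<open>0\<close>, raise \<open>H s\<close> by at most one so that its parity differs from
  that of \<open>\<alpha>\<close> exactly when \<open>G s = 1\<close>. As a mind change costs at least one step, the raised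
  bound still decreases, and the sets \<open>A \<eta>\<close> of those \<open>f\<close> whose raised bound drops to \<open>\<eta>\<close> or
  below represent the guessed set. Initial guess \<open>1\<close> leads to the complement instead.
\<close>

lemma ord_parity_less_2: "ord_parity \<eta> < 2"
  and ord_parity_ord_suc: "ord_parity (ord_suc \<eta>) = 1 - ord_parity \<eta>"
proof -
  obtain \<mu> n where \<mu>: "\<mu> = ord_zero \<or> limit_ord \<mu>" "\<eta> = (ord_suc ^^ n) \<mu>"
    using ord_decomp[of \<eta>] by blast
  have "ord_parity \<eta> = n mod 2"
    using ord_parity_eq[OF \<mu>(1)] \<mu>(2) by simp
  moreover have "ord_parity (ord_suc \<eta>) = Suc n mod 2"
    using ord_parity_eq[OF \<mu>(1), of "Suc n"] \<mu>(2) by simp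
  ultimately show "ord_parity \<eta> < 2" "ord_parity (ord_suc \<eta>) = 1 - ord_parity \<eta>"
    by (auto simp: mod_Suc)
qed

text \<open>There are only two parities, so one successor step always repairs a wrong one.\<close>

lemma ord_parity_ord_suc_neq_iff:
  "ord_parity (ord_suc \<eta>) \<noteq> ord_parity \<theta> \<longleftrightarrow> ord_parity \<eta> = ord_parity \<theta>"
  using ord_parity_less_2[of \<eta>] ord_parity_less_2[of \<theta>] ord_parity_ord_suc[of \<eta>] by presburger

lemma less_ord_suc_iff: "\<beta> < ord_suc \<alpha> \<longleftrightarrow> \<beta> \<le> \<alpha>"
  by (meson leD le_less_trans less_ord_suc not_le ord_suc_least)

lemma is_guesser_iff_eventually:
  "is_guesser S G \<longleftrightarrow>
     range G \<subseteq> {0, 1} \<and> (\<forall>f. \<forall>\<^sub>F n in sequentially. G (f \<restriction> n) = indicator S f)"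
  unfolding is_guesser_def by (simp add: tendsto_discrete)

lemma is_guesser_Compl:
  assumes "is_guesser S G"
  shows "is_guesser (UNIV - S) (\<lambda>s. 1 - G s)"
  unfolding is_guesser_iff_eventually
proof (intro conjI allI)
  show "range (\<lambda>s. 1 - G s) \<subseteq> {0, 1}" by auto
next
  fix f
  have "\<forall>\<^sub>F n in sequentially. G (f \<restriction> n) = indicator S f"
    using assms unfolding is_guesser_iff_eventually by blast
  then show "\<forall>\<^sub>F n in sequentially. 1 - G (f \<restriction> n) = indicator (UNIV - S) f"
    by eventually_elim (simp add: indicator_def)
qed

text \<open>Exchanging the guesses 0 and 1 leaves the mind changes where they are, so the same
  \<open>H\<close> bounds them.\<close>

lemma guessable_Compl:
  assumes "guessable_with_less_mind_changes \<gamma> S"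
  shows "guessable_with_less_mind_changes \<gamma> (UNIV - S)"
proof -
  obtain G :: "nat list \<Rightarrow> nat" and H :: "nat list \<Rightarrow> 'a" where
    "is_guesser S G" "range H \<subseteq> {..<\<gamma>}" and
    "\<And>f n. H (f \<restriction> (n + 1)) \<le> H (f \<restriction> n)"
    "\<And>f n. G (f \<restriction> (n + 1)) \<noteq> G (f \<restriction> n) \<Longrightarrow> H (f \<restriction> (n + 1)) < H (f \<restriction> n)"
    using assms unfolding guessable_with_less_mind_changes_def by blast
  then show ?thesis
    unfolding guessable_with_less_mind_changes_def
    by (intro exI[of _ "\<lambda>s. 1 - G s"] exI[of _ H]) (use is_guesser_Compl in fastforce)
qed

lemma initial_segment_eq_iff: "g \<restriction> n = f \<restriction> n \<longleftrightarrow> (\<forall>i<n. g i = f i)"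
  by (auto simp: initial_segment_def)

lemma initial_segment_eq_mono: "g \<restriction> n = f \<restriction> n \<Longrightarrow> m \<le> n \<Longrightarrow> g \<restriction> m = f \<restriction> m"
  by (simp add: initial_segment_eq_iff)

lemma length_initial_segment [simp]: "length (f \<restriction> n) = n"
  by (simp add: initial_segment_def)

lemma difference_class_guessable:
  fixes \<alpha> :: "'o::{wellorder,no_top}"
  assumes "S \<in> difference_class \<alpha>"
  shows "guessable_with_less_mind_changes (ord_suc \<alpha>) S"
proof -
  obtain A where S: "S = difference_set \<alpha> A" and A: "\<And>\<eta>. \<eta> < \<alpha> \<Longrightarrow> open (A \<eta>)"
    using assms unfolding difference_class_def by blast
  define C where "C s = {g. g \<restriction> length s = s}" for s
  \<comment> \<open>The alternative \<open>\<eta> = \<alpha>\<close> ensures that a minimum exists;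
    it is attained when no set is secured by \<open>s\<close> yet, and \<open>G\<close> then guesses
    0.\<close>
  define P where "P s \<eta> \<longleftrightarrow> \<eta> = \<alpha> \<or> \<eta> < \<alpha> \<and> C s \<subseteq> A \<eta>" for s \<eta>
  define H where "H s = (LEAST \<eta>. P s \<eta>)" for s
  define G :: "nat list \<Rightarrow> nat"
    where "G s = (if ord_parity (H s) \<noteq> ord_parity \<alpha> then 1 else 0)" for s
  have PH: "P s (H s)" for s
    unfolding H_def by (rule LeastI[of _ \<alpha>]) (simp add: P_def)
  have H_le: "H s \<le> \<eta>" if "P s \<eta>" for s \<eta>
    using that unfolding H_def by (rule Least_le)
  have C_mono: "C (f \<restriction> n) \<subseteq> C (f \<restriction> m)" if "m \<le> n" for f m n
    using that by (auto simp: C_def intro: initial_segment_eq_mono)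
  have H_mono: "H (f \<restriction> n) \<le> H (f \<restriction> m)" if "m \<le> n" for f m n
    using C_mono[OF that, of f] PH[of "f \<restriction> m"] by (intro H_le) (auto simp: P_def)
  have mem: "f \<in> A (H (f \<restriction> n))" if "H (f \<restriction> n) \<noteq> \<alpha>" for f n
    using PH[of "f \<restriction> n"] that by (auto simp: P_def C_def)
  have H_le_\<alpha>: "H s \<le> \<alpha>" for s
    by (rule H_le) (simp add: P_def)
  have "\<forall>\<^sub>F n in sequentially. G (f \<restriction> n) = indicator S f" for f
  proof (cases "\<exists>\<eta><\<alpha>. f \<in> A \<eta>")
    case True
    define m where "m = (LEAST \<eta>. \<eta> < \<alpha> \<and> f \<in> A \<eta>)"
    have m: "m < \<alpha>" "f \<in> A m"
      using LeastI_ex[OF True] by (auto simp: m_def)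
    obtain n where "{g. g \<restriction> n = f \<restriction> n} \<subseteq> A m"
      using A[OF m(1)] m(2) unfolding baire_open_iff by blast
    then have n: "H (f \<restriction> n) \<le> m"
      using m(1) by (intro H_le) (simp add: P_def C_def)
    \<comment> \<open>Any value of \<open>H\<close> below \<alpha> is the index of a set containing
      \<open>f\<close>, so it cannot undercut \<open>m\<close>.\<close>
    have "H (f \<restriction> k) = m" if "n \<le> k" for k
    proof (rule antisym)
      show "H (f \<restriction> k) \<le> m" using H_mono[OF that, of f] n by simp
      then have "H (f \<restriction> k) < \<alpha>" using m(1) by simp
      then show "m \<le> H (f \<restriction> k)"
        using mem[of f k] unfolding m_def by (intro Least_le) auto
    qed
    then have "\<forall>\<^sub>F k in sequentially. H (f \<restriction> k) = m"
      by (auto simp: eventually_sequentially)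
    moreover have "f \<in> S \<longleftrightarrow> ord_parity m \<noteq> ord_parity \<alpha>"
      unfolding S difference_set_def m_def using True by auto
    ultimately show ?thesis
      by (auto elim!: eventually_mono simp: G_def indicator_def)
  next
    case False
    then have "H (f \<restriction> n) = \<alpha>" for n
      using mem[of f n] H_le_\<alpha>[of "f \<restriction> n"] by force
    moreover have "f \<notin> S"
      using False unfolding S difference_set_def by auto
    ultimately show ?thesis
      by (simp add: G_def)
  qed
  then have "is_guesser S G"
    unfolding is_guesser_iff_eventually by (auto simp: G_def)
  moreover have "range H \<subseteq> {..<ord_suc \<alpha>}"
    using H_le_\<alpha> by (auto simp: less_ord_suc_iff)
  moreover have "H (f \<restriction> (n + 1)) < H (f \<restriction> n)" if "G (f \<restriction> (n + 1)) \<noteq> G (f \<restriction> n)" for f n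
  proof -
    have "H (f \<restriction> (n + 1)) \<noteq> H (f \<restriction> n)"
      using that unfolding G_def by metis
    then show ?thesis
      using H_mono[of n "n + 1" f] by simp
  qed
  moreover have "H (f \<restriction> (n + 1)) \<le> H (f \<restriction> n)" for f n
    by (rule H_mono) simp
  ultimately show ?thesis
    unfolding guessable_with_less_mind_changes_def by blast
qed

text \<open>The initial guess 0 matches the parity condition at the value \<alpha>, where raising
  the bound would lead beyond \<alpha>.\<close>

lemma guesser_in_difference_class:
  fixes \<alpha> :: "'o::{wellorder,no_top}" and H :: "nat list \<Rightarrow> 'o"
  assumes G: "is_guesser S G" and G0: "G [] = 0"
    and H_le: "\<And>s. H s \<le> \<alpha>"
    and H_dec: "\<And>f n. H (f \<restriction> (n + 1)) \<le> H (f \<restriction> n)"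
    and change: "\<And>f n. G (f \<restriction> (n + 1)) \<noteq> G (f \<restriction> n) \<Longrightarrow> H (f \<restriction> (n + 1)) < H (f \<restriction> n)"
  shows "S \<in> difference_class \<alpha>"
proof -
  define K where
    "K s = (if (ord_parity (H s) \<noteq> ord_parity \<alpha>) = (G s = 1) then H s else ord_suc (H s))" for s
  define A where "A \<eta> = {f. \<exists>n. K (f \<restriction> n) \<le> \<eta>}" for \<eta>
  have K_parity: "ord_parity (K s) \<noteq> ord_parity \<alpha> \<longleftrightarrow> G s = 1" for s
    using ord_parity_ord_suc_neq_iff[of "H s" \<alpha>] by (auto simp: K_def)
  have H_le_K: "H s \<le> K s" for s
    using less_ord_suc[of "H s"] by (auto simp: K_def)
  \<comment> \<open>While \<open>H\<close> is still at \<alpha> it has never dropped, so no mind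
    change has occurred.\<close>
  have top: "G (f \<restriction> n) = 0" if "H (f \<restriction> n) = \<alpha>" for f n
    using that
  proof (induction n)
    case 0
    then show ?case using G0 by (simp add: initial_segment_def)
  next
    case (Suc n)
    have "H (f \<restriction> n) = \<alpha>"
      using H_dec[of f n] H_le[of "f \<restriction> n"] Suc.prems by simp
    then show ?case
      using Suc change[of f n] by fastforce
  qed
  have K_le: "K (f \<restriction> n) \<le> \<alpha>" for f n
  proof (cases "H (f \<restriction> n) = \<alpha>")
    case True
    then show ?thesis using top[OF True] by (simp add: K_def)
  next
    case False
    then have "H (f \<restriction> n) < \<alpha>" using H_le[of "f \<restriction> n"] by simp
    then show ?thesis using ord_suc_least by (auto simp: K_def)
  qed
  \<comment> \<open>If \<open>H\<close> stays, so do \<open>G\<close> and \<open>K\<close>; if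
    \<open>H\<close> drops, the successor of its new value is at most the old value, which absorbs
    the raise.\<close>
  have K_step: "K (f \<restriction> Suc n) \<le> K (f \<restriction> n)" for f n
  proof (cases "H (f \<restriction> Suc n) = H (f \<restriction> n)")
    case True
    then have "G (f \<restriction> Suc n) = G (f \<restriction> n)" using change[of f n] by auto
    then show ?thesis using True by (simp add: K_def)
  next
    case False
    then have "H (f \<restriction> Suc n) < H (f \<restriction> n)" using H_dec[of f n] by simp
    then have "K (f \<restriction> Suc n) \<le> H (f \<restriction> n)"
      using ord_suc_least by (auto simp: K_def)
    then show ?thesis using H_le_K order_trans by blast
  qed
  have K_mono: "K (f \<restriction> n) \<le> K (f \<restriction> m)" if "m \<le> n" for f m n
    using that K_step by (rule lift_Suc_antimono_le[of "\<lambda>n. K (f \<restriction> n)", rotated])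
  have "f \<in> S \<longleftrightarrow> f \<in> difference_set \<alpha> A" for f
  proof -
    \<comment> \<open>The least value of \<open>K\<close> along \<open>f\<close> is also its
      eventual value, and the least index of a set containing \<open>f\<close>.\<close>
    define m where "m = (LEAST \<kappa>. \<exists>n. K (f \<restriction> n) = \<kappa>)"
    obtain n where n: "K (f \<restriction> n) = m"
      using LeastI_ex[of "\<lambda>\<kappa>. \<exists>n. K (f \<restriction> n) = \<kappa>"] unfolding m_def by blast
    have m_le: "m \<le> K (f \<restriction> k)" for k
      unfolding m_def by (rule Least_le) blast
    have A_iff: "f \<in> A \<eta> \<longleftrightarrow> m \<le> \<eta>" for \<eta>
      using n m_le order_trans unfolding A_def by blast
    obtain N where N: "\<And>k. N \<le> k \<Longrightarrow> G (f \<restriction> k) = indicator S f"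
      using G unfolding is_guesser_iff_eventually eventually_sequentially by blast
    \<comment> \<open>At \<open>max n N\<close> both \<open>K\<close> and \<open>G\<close> have
      settled, so the parity of \<open>m\<close> reveals the final guess.\<close>
    have "K (f \<restriction> max n N) = m"
      using K_mono[of n "max n N" f] n m_le[of "max n N"] by simp
    then have S_iff: "f \<in> S \<longleftrightarrow> ord_parity m \<noteq> ord_parity \<alpha>"
      using K_parity[of "f \<restriction> max n N"] N[of "max n N"] by (simp add: indicator_def)
    show ?thesis
    proof (cases "m < \<alpha>")
      case True
      then have "(LEAST \<eta>. \<eta> < \<alpha> \<and> f \<in> A \<eta>) = m"
        by (intro Least_equality) (auto simp: A_iff)
      then show ?thesis
        using True S_iff by (auto simp: difference_set_def A_iff)
    next
      case False
      \<comment> \<open>Here no set with index below \<alpha> contains \<open>f\<close>, and the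
        parity of \<open>m\<close> is that of \<alpha>: both sides are false.\<close>
      then have "m = \<alpha>" using K_le[of f n] n by simp
      then show ?thesis
        using S_iff by (auto simp: difference_set_def A_iff)
    qed
  qed
  then have "S = difference_set \<alpha> A" by blast
  moreover have "mono_on {..<\<alpha>} A"
    by (auto simp: mono_on_def A_def intro: order_trans)
  \<comment> \<open>A single finite prefix witnesses membership, and all its extensions share
    it.\<close>
  moreover have "open (A \<eta>)" for \<eta>
    unfolding baire_open_iff A_def by (clarsimp, metis (mono_tags) mem_Collect_eq subsetI)
  ultimately show ?thesis
    unfolding difference_class_def by blast
qed

theorem theorem4p2:
  fixes \<alpha> :: "'o::{wellorder,no_top}" and S :: "(nat \<Rightarrow> nat) set"
  assumes "\<alpha> > ord_zero"
  shows "guessable_with_less_mind_changes (ord_suc \<alpha>) S \<longleftrightarrow>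
         S \<in> difference_class \<alpha> \<or> UNIV - S \<in> difference_class \<alpha>"
proof
  assume "guessable_with_less_mind_changes (ord_suc \<alpha>) S"
  then obtain G :: "nat list \<Rightarrow> nat" and H :: "nat list \<Rightarrow> 'o" where
    G: "is_guesser S G" and H: "range H \<subseteq> {..<ord_suc \<alpha>}" and
    dec: "\<And>f n. H (f \<restriction> (n + 1)) \<le> H (f \<restriction> n)" and
    change: "\<And>f n. G (f \<restriction> (n + 1)) \<noteq> G (f \<restriction> n) \<Longrightarrow> H (f \<restriction> (n + 1)) < H (f \<restriction> n)"
    unfolding guessable_with_less_mind_changes_def by blast
  have H_le: "H s \<le> \<alpha>" for s
    using H less_ord_suc_iff by blast
  have "G [] = 0 \<or> G [] = 1"
    using G unfolding is_guesser_def by blast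
  then show "S \<in> difference_class \<alpha> \<or> UNIV - S \<in> difference_class \<alpha>"
  proof
    assume "G [] = 0"
    then show ?thesis
      using guesser_in_difference_class[OF G _ H_le dec change] by blast
  next
    assume "G [] = 1"
    \<comment> \<open>The flipped guesser starts with 0 and changes only where \<open>G\<close>
      does, so \<open>H\<close> serves it too.\<close>
    then have "UNIV - S \<in> difference_class \<alpha>"
      by (intro guesser_in_difference_class[OF is_guesser_Compl[OF G] _ H_le dec])
        (auto intro!: change[simplified])
    then show ?thesis ..
  qed
next
  assume "S \<in> difference_class \<alpha> \<or> UNIV - S \<in> difference_class \<alpha>"
  then show "guessable_with_less_mind_changes (ord_suc \<alpha>) S"
  proof
    assume "UNIV - S \<in> difference_class \<alpha>"
    then show ?thesis
      using guessable_Compl[OF difference_class_guessable, of "UNIV - S" \<alpha>]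
      by (simp add: Diff_Diff_Int)
  qed (rule difference_class_guessable)
qed

end
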